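(* Let $(X,d,\succcurlyeq)$ be a radial metric poset. Every $\succcurlyeq$-increasing, bounded and uniformly continuous real-valued map on a subset $S$ of $X$ can be extended to an $\succcurlyeq$-increasing and uniformly continuous real-valued map on $X$.
   Context: A metric poset is a triple $(X,d,\succcurlyeq)$ where $X$ is a nonempty set, $(X,d)$ is a metric space, and $\succcurlyeq$ is a partial order on $X$ that is closed as a subset of $X\times X$. Write $x\succ y$ if $x\succcurlyeq y$ and $x\neq y$, and write $x\succcurlyeq^{\bullet}y$ if it is not the case that $y\succcurlyeq x$. $(X,d,\succcurlyeq)$ is radial if for all $x,y,z\in X$: (i) $x\succcurlyeq^{\bullet}y\succ z$ implies $d(x,z)\ge d(x,y)$; and (ii) $x\succ y\succcurlyeq^{\bullet}z$ implies $d(x,z)\ge d(y,z)$. For $A\subseteq X$, a function $g:A\to\mathbb{R}$ is $\succcurlyeq$-increasing if $g(x)\ge g(y)$ for all $x,y\in A$ with $x\succcurlyeq y$. Subsets of $X$ carry the metric $d$ restricted to them. *)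

theory Defs
  imports "HOL-Analysis.Analysis"
begin

text \<open>
  The order is a relation \<open>R\<close> on the carrier, where \<open>(x, y) \<in> R\<close> reads
  \<open>x \<succcurlyeq> y\<close>: the larger element comes first.
\<close>

locale metric_poset = Metric_space X d
  for X :: "'a set" and d :: "'a \<Rightarrow> 'a \<Rightarrow> real" and R :: "'a rel" +
  assumes nonempty: "X \<noteq> {}"
    and partial_order: "partial_order_on X R"
    and closed_order: "closedin (prod_topology mtopology mtopology) R"

definition strictly_above :: "'a rel \<Rightarrow> 'a \<Rightarrow> 'a \<Rightarrow> bool"
  where "strictly_above R x y \<longleftrightarrow> (x, y) \<in> R \<and> x \<noteq> y"

text \<open>
  The relation \<open>\<succcurlyeq>\<^sup>\<bullet>\<close>. It also holds between incomparable elements, so it is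
  weaker than \<^const>\<open>strictly_above\<close> unless \<open>R\<close> is total.
\<close>

definition not_below :: "'a rel \<Rightarrow> 'a \<Rightarrow> 'a \<Rightarrow> bool"
  where "not_below R x y \<longleftrightarrow> (y, x) \<notin> R"

locale radial_metric_poset = metric_poset X d R
  for X :: "'a set" and d :: "'a \<Rightarrow> 'a \<Rightarrow> real" and R :: "'a rel" +
  assumes radial_above:
    "\<lbrakk>x \<in> X; y \<in> X; z \<in> X; not_below R x y; strictly_above R y z\<rbrakk> \<Longrightarrow> d x z \<ge> d x y"
    and radial_below:
    "\<lbrakk>x \<in> X; y \<in> X; z \<in> X; strictly_above R x y; not_below R y z\<rbrakk> \<Longrightarrow> d x z \<ge> d y z"

definition increasing_on :: "'a rel \<Rightarrow> 'a set \<Rightarrow> ('a \<Rightarrow> real) \<Rightarrow> bool"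
  where "increasing_on R A g \<longleftrightarrow> (\<forall>x\<in>A. \<forall>y\<in>A. (x, y) \<in> R \<longrightarrow> g x \<ge> g y)"

end

theory Submission
  imports Defs
begin

text \<open>
  The map \<open>f\<close> has a modulus of continuity \<open>w\<close> that is nondecreasing, subadditive and tends to
  \<open>0\<close> at \<open>0\<close>; boundedness of \<open>f\<close> is what makes subadditivity attainable
  (\<open>subadditive_modulus_exists\<close>). Radiality only compares distances with one another, so it
  survives when \<open>d\<close> is replaced by \<open>w \<circ> d\<close>, and with respect to \<open>w \<circ> d\<close> the map \<open>f\<close> is
  \<open>1\<close>-Lipschitz. It remains to extend an increasing \<open>1\<close>-Lipschitz map.

  McShane's formula \<open>g x = (INF s\<in>S. f s + w (d x s))\<close> extends \<open>f\<close> with the same modulus, but the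
  result need not be increasing. The remedy is to charge nothing for moving down from \<open>s\<close> to \<open>x\<close>,
  replacing \<open>w (d x s)\<close> by the cost that vanishes when \<open>s \<succcurlyeq> x\<close>. Since \<open>f\<close> is
  increasing, this does not push \<open>g\<close> below \<open>f\<close> on \<open>S\<close>. The two halves of radiality are exactly
  what the cost needs: condition (ii) makes it increasing in \<open>x\<close>, and condition (i) keeps
  its modulus at \<open>w\<close> where the case distinction jumps
  (\<open>descent_cost_mono\<close>, \<open>descent_cost_triangle\<close>).
\<close>

section \<open>Subadditive moduli of continuity\<close>

text \<open>
  The modulus is the infimum of all affine majorants \<open>a + L * t\<close> of the oscillation of \<open>f\<close>. It is
  subadditive because, of two majorants, the one with the smaller slope bounds the value at
  \<open>s + t\<close> by the sum of the two values at \<open>s\<close> and at \<open>t\<close>. Boundedness enters through the existence,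
  for every \<open>a > 0\<close>, of a majorant with intercept \<open>a\<close>: distances of at least \<open>\<delta>\<close> are covered by a
  steep enough slope.
\<close>

lemma subadditive_modulus_exists:
  fixes f :: "'a \<Rightarrow> real" and d :: "'a \<Rightarrow> 'a \<Rightarrow> real"
  assumes dist_nonneg: "\<And>x y. d x y \<ge> 0"
    and bounded: "bounded (f ` S)"
    and unif: "\<And>e. e > 0 \<Longrightarrow> \<exists>\<delta>>0. \<forall>x\<in>S. \<forall>y\<in>S. d x y < \<delta> \<longrightarrow> \<bar>f x - f y\<bar> < e"
  obtains w :: "real \<Rightarrow> real"
  where "mono_on {0..} w" and "w 0 = 0"
    and "\<And>s t. s \<ge> 0 \<Longrightarrow> t \<ge> 0 \<Longrightarrow> w (s + t) \<le> w s + w t"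
    and "\<And>x y. x \<in> S \<Longrightarrow> y \<in> S \<Longrightarrow> \<bar>f x - f y\<bar> \<le> w (d x y)"
    and "\<And>e. e > 0 \<Longrightarrow> \<exists>\<delta>>0. \<forall>t. 0 \<le> t \<and> t < \<delta> \<longrightarrow> w t < e"
proof -
  define P where
    "P = {(a, L). a \<ge> 0 \<and> L \<ge> 0 \<and> (\<forall>x\<in>S. \<forall>y\<in>S. \<bar>f x - f y\<bar> \<le> a + L * d x y)}"
  define w where "w t = (INF (a, L)\<in>P. a + L * t)" for t
  have small_intercept: "\<exists>L\<ge>0. (a, L) \<in> P" if "a > 0" for a
  proof -
    obtain \<delta> where \<delta>: "\<delta> > 0" "\<And>x y. x \<in> S \<Longrightarrow> y \<in> S \<Longrightarrow> d x y < \<delta> \<Longrightarrow> \<bar>f x - f y\<bar> < a"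
      using unif[OF \<open>a > 0\<close>] by blast
    obtain B where B: "B > 0" "\<And>x. x \<in> S \<Longrightarrow> \<bar>f x\<bar> \<le> B"
      using bounded by (auto simp: bounded_pos)
    have "\<bar>f x - f y\<bar> \<le> a + (2 * B / \<delta>) * d x y" if "x \<in> S" "y \<in> S" for x y
    proof (cases "d x y < \<delta>")
      case True
      moreover have "(2 * B / \<delta>) * d x y \<ge> 0"
        using B(1) \<delta>(1) dist_nonneg by simp
      ultimately show ?thesis
        using \<delta>(2)[OF that] by linarith
    next
      case False
      have "\<bar>f x - f y\<bar> \<le> (2 * B / \<delta>) * \<delta>"
        using B(2)[OF that(1)] B(2)[OF that(2)] \<delta>(1) by simp
      also have "\<dots> \<le> (2 * B / \<delta>) * d x y"
        using False B(1) \<delta>(1) by (intro mult_left_mono) auto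
      finally show ?thesis
        using \<open>a > 0\<close> by linarith
    qed
    then show ?thesis
      using B(1) \<delta>(1) \<open>a > 0\<close> by (intro exI[of _ "2 * B / \<delta>"]) (auto simp: P_def)
  qed
  have P_nonempty: "P \<noteq> {}"
    using small_intercept[of 1] by auto
  have w_le: "w t \<le> a + L * t" if "(a, L) \<in> P" "t \<ge> 0" for a L t
    unfolding w_def
    using that by (intro cINF_lower2[OF _ that(1)] bdd_belowI2[of _ 0]) (auto simp: P_def)
  have w_ge: "c \<le> w t" if "\<And>a L. (a, L) \<in> P \<Longrightarrow> c \<le> a + L * t" for c t
    unfolding w_def using that P_nonempty by (intro cINF_greatest) auto
  show ?thesis
  proof
    show "mono_on {0..} w"
    proof (rule mono_onI)
      fix s t :: real assume st: "s \<in> {0..}" "t \<in> {0..}" "s \<le> t"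
      show "w s \<le> w t"
      proof (rule w_ge)
        fix a L assume aL: "(a, L) \<in> P"
        then have "L * s \<le> L * t"
          using st by (auto simp: P_def intro: mult_left_mono)
        then show "w s \<le> a + L * t"
          using w_le[OF aL, of s] st by simp
      qed
    qed
    show "w 0 = 0"
    proof (rule antisym)
      show "w 0 \<le> 0"
      proof (rule field_le_epsilon)
        fix e :: real assume "e > 0"
        then show "w 0 \<le> 0 + e"
          using small_intercept[of e] w_le[of e _ 0] by auto
      qed
      show "0 \<le> w 0"
        by (rule w_ge) (auto simp: P_def)
    qed
    show "w (s + t) \<le> w s + w t" if s: "s \<ge> 0" and t: "t \<ge> 0" for s t
    proof -
      have pair: "w (s + t) \<le> (a + L * s) + (b + K * t)"
        if aL: "(a, L) \<in> P" and bK: "(b, K) \<in> P" for a L b K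
      proof (cases "L \<le> K")
        case True
        then have "L * t \<le> K * t"
          using t by (intro mult_right_mono)
        moreover have "b \<ge> 0"
          using bK by (auto simp: P_def)
        ultimately show ?thesis
          using w_le[OF aL, of "s + t"] s t by (simp add: distrib_left)
      next
        case False
        then have "K * s \<le> L * s"
          using s by (intro mult_right_mono) auto
        moreover have "a \<ge> 0"
          using aL by (auto simp: P_def)
        ultimately show ?thesis
          using w_le[OF bK, of "s + t"] s t by (simp add: distrib_left)
      qed
      have "w (s + t) - w t \<le> w s"
      proof (rule w_ge)
        fix a L assume aL: "(a, L) \<in> P"
        have "w (s + t) - (a + L * s) \<le> w t"
          using pair[OF aL] by (intro w_ge) (simp add: diff_le_eq add.commute)
        then show "w (s + t) - w t \<le> a + L * s"
          by linarith
      qed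
      then show ?thesis
        by linarith
    qed
    show "\<bar>f x - f y\<bar> \<le> w (d x y)" if "x \<in> S" "y \<in> S" for x y
      using that by (intro w_ge) (auto simp: P_def)
    show "\<exists>\<delta>>0. \<forall>t. 0 \<le> t \<and> t < \<delta> \<longrightarrow> w t < e" if "e > 0" for e
    proof -
      obtain L where L: "L \<ge> 0" "(e / 2, L) \<in> P"
        using small_intercept[of "e / 2"] \<open>e > 0\<close> by auto
      \<comment> \<open>The summand \<open>1\<close> keeps the radius defined when the slope is \<open>0\<close>.\<close>
      have "w t < e" if t: "0 \<le> t" "t < e / (2 * (L + 1))" for t
      proof -
        have "(L + 1) * t < e / 2"
          using t(2) L(1) by (simp add: field_simps)
        then have "e / 2 + L * t < e"
          using t(1) by (simp add: distrib_right)
        then show ?thesis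
          using w_le[OF L(2) t(1)] by linarith
      qed
      then show ?thesis
        using L(1) \<open>e > 0\<close> by (intro exI[of _ "e / (2 * (L + 1))"]) auto
    qed
  qed
qed

section \<open>Increasing extension with a prescribed modulus\<close>

context radial_metric_poset
begin

definition descent_cost :: "(real \<Rightarrow> real) \<Rightarrow> 'a \<Rightarrow> 'a \<Rightarrow> real"
  where "descent_cost w x s = (if (s, x) \<in> R then 0 else w (d x s))"

lemma order_trans: "(x, y) \<in> R \<Longrightarrow> (y, z) \<in> R \<Longrightarrow> (x, z) \<in> R"
  using partial_order unfolding partial_order_on_def preorder_on_def by (meson transD)

lemma order_refl: "x \<in> X \<Longrightarrow> (x, x) \<in> R"
  using partial_order unfolding partial_order_on_def preorder_on_def by (meson refl_onD)

text \<open>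
  The only case with content is \<open>x \<noteq> y\<close> with \<open>s\<close> not above \<open>y\<close>, hence by transitivity not above
  \<open>x\<close>. Then \<open>x \<succ> y \<succcurlyeq>\<^sup>\<bullet> s\<close>, and condition (ii) of radiality says that \<open>x\<close> is at least as far
  from \<open>s\<close> as \<open>y\<close> is.
\<close>

lemma descent_cost_mono:
  assumes w: "mono_on {0..} w" "w 0 = 0"
    and X: "x \<in> X" "y \<in> X" "s \<in> X" and xy: "(x, y) \<in> R"
  shows "descent_cost w y s \<le> descent_cost w x s"
proof -
  have nonneg: "w (d u v) \<ge> 0" for u v
    using mono_onD[OF w(1), of 0 "d u v"] w(2) by simp
  consider "(s, y) \<in> R" | "x = y" | "(s, y) \<notin> R" "x \<noteq> y"
    by blast
  then show ?thesis
  proof cases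
    case 3
    then have "(s, x) \<notin> R"
      using order_trans xy by blast
    moreover have "d y s \<le> d x s"
      using radial_below[OF X] 3 xy by (simp add: strictly_above_def not_below_def)
    ultimately show ?thesis
      using 3 mono_onD[OF w(1), of "d y s" "d x s"] by (simp add: descent_cost_def)
  qed (auto simp: descent_cost_def nonneg)
qed

text \<open>
  The triangle inequality does not help when \<open>s\<close> lies above \<open>y\<close> but not above \<open>x\<close>, because the cost
  at \<open>y\<close> is then \<open>0\<close>. But unless \<open>s = y\<close> this means \<open>x \<succcurlyeq>\<^sup>\<bullet> s \<succ> y\<close>, and condition (i) of
  radiality bounds the distance from \<open>x\<close> to \<open>s\<close> by that from \<open>x\<close> to \<open>y\<close>.
\<close>

lemma descent_cost_triangle:
  assumes w: "mono_on {0..} w" "w 0 = 0"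
    and subadd: "\<And>s t. s \<ge> 0 \<Longrightarrow> t \<ge> 0 \<Longrightarrow> w (s + t) \<le> w s + w t"
    and X: "x \<in> X" "y \<in> X" "s \<in> X"
  shows "descent_cost w x s \<le> w (d x y) + descent_cost w y s"
proof -
  have nonneg: "w (d u v) \<ge> 0" for u v
    using mono_onD[OF w(1), of 0 "d u v"] w(2) by simp
  consider "(s, x) \<in> R" | "(s, x) \<notin> R" "(s, y) \<in> R" | "(s, x) \<notin> R" "(s, y) \<notin> R"
    by blast
  then show ?thesis
  proof cases
    case 1
    then show ?thesis
      by (simp add: descent_cost_def nonneg)
  next
    case 2
    have "d x s \<le> d x y"
    proof (cases "s = y")
      case False
      then show ?thesis
        using radial_above[OF X(1,3,2)] 2 by (simp add: strictly_above_def not_below_def)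
    qed simp
    then show ?thesis
      using 2 mono_onD[OF w(1), of "d x s" "d x y"] by (simp add: descent_cost_def)
  next
    case 3
    have "w (d x s) \<le> w (d x y + d y s)"
      using mono_onD[OF w(1), of "d x s" "d x y + d y s"] triangle[OF X] by simp
    also have "\<dots> \<le> w (d x y) + w (d y s)"
      by (rule subadd) simp_all
    finally show ?thesis
      using 3 by (simp add: descent_cost_def)
  qed
qed

text \<open>
  This is the order-sensitive McShane extension. The empty domain is split off because the infimum
  that defines the extension is then taken over the empty set.
\<close>

lemma increasing_extension_with_modulus:
  fixes f :: "'a \<Rightarrow> real"
  assumes w: "mono_on {0..} w" "w 0 = 0"
    and subadd: "\<And>s t. s \<ge> 0 \<Longrightarrow> t \<ge> 0 \<Longrightarrow> w (s + t) \<le> w s + w t"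
    and S: "S \<subseteq> X" and incr: "increasing_on R S f" and bdd: "bdd_below (f ` S)"
    and modulus: "\<And>x y. x \<in> S \<Longrightarrow> y \<in> S \<Longrightarrow> \<bar>f x - f y\<bar> \<le> w (d x y)"
  obtains g :: "'a \<Rightarrow> real"
  where "\<And>x. x \<in> S \<Longrightarrow> g x = f x" and "increasing_on R X g"
    and "\<And>x y. x \<in> X \<Longrightarrow> y \<in> X \<Longrightarrow> \<bar>g x - g y\<bar> \<le> w (d x y)"
proof (cases "S = {}")
  case True
  have "w (d x y) \<ge> 0" for x y
    using mono_onD[OF w(1), of 0 "d x y"] w(2) by simp
  then show ?thesis
    using that[of "\<lambda>_. 0"] True by (simp add: increasing_on_def)
next
  case False
  define g where "g x = (INF s\<in>S. f s + descent_cost w x s)" for x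
  have cost_nonneg: "descent_cost w x s \<ge> 0" for x s
    using mono_onD[OF w(1), of 0 "d x s"] w(2) by (simp add: descent_cost_def)
  obtain b where b: "\<And>s. s \<in> S \<Longrightarrow> b \<le> f s"
    using bdd by (auto simp: bdd_below_def)
  have "bdd_below ((\<lambda>s. f s + descent_cost w x s) ` S)" for x
    using b cost_nonneg by (intro bdd_belowI2[of _ b]) (simp add: add_increasing2)
  then have g_le: "g x \<le> f s + descent_cost w x s" if "s \<in> S" for x s
    unfolding g_def using that by (rule cINF_lower)
  have g_ge: "c \<le> g x" if "\<And>s. s \<in> S \<Longrightarrow> c \<le> f s + descent_cost w x s" for c x
    unfolding g_def using that False by (intro cINF_greatest)
  have one_sided: "g x - w (d x y) \<le> g y" if "x \<in> X" "y \<in> X" for x y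
  proof (rule g_ge)
    fix s assume s: "s \<in> S"
    then show "g x - w (d x y) \<le> f s + descent_cost w y s"
      using g_le[OF s, of x] descent_cost_triangle[OF w subadd that, of s] S by auto
  qed
  show ?thesis
  proof
    show "g x = f x" if x: "x \<in> S" for x
    proof (rule antisym)
      show "g x \<le> f x"
        using g_le[OF x, of x] order_refl[of x] x S by (auto simp: descent_cost_def)
      show "f x \<le> g x"
      proof (rule g_ge)
        fix s assume s: "s \<in> S"
        show "f x \<le> f s + descent_cost w x s"
          using modulus[OF x s] incr x s by (auto simp: descent_cost_def increasing_on_def)
      qed
    qed
    show "increasing_on R X g"
      unfolding increasing_on_def
    proof (intro ballI impI)
      fix x y assume xy: "x \<in> X" "y \<in> X" "(x, y) \<in> R"
      show "g y \<le> g x"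
      proof (rule g_ge)
        fix s assume s: "s \<in> S"
        then show "g y \<le> f s + descent_cost w x s"
          using g_le[OF s, of y] descent_cost_mono[OF w xy(1,2) _ xy(3), of s] S by auto
      qed
    qed
    show "\<bar>g x - g y\<bar> \<le> w (d x y)" if "x \<in> X" "y \<in> X" for x y
      using one_sided[OF that] one_sided[OF that(2,1)] by (simp add: commute)
  qed
qed

end

section \<open>Uniformly continuous extension\<close>

theorem corollary14:
  fixes X S :: "'a set" and d :: "'a \<Rightarrow> 'a \<Rightarrow> real" and R :: "'a rel"
    and f :: "'a \<Rightarrow> real"
  assumes "radial_metric_poset X d R"
    and "S \<subseteq> X"
    and "increasing_on R S f"
    and "bounded (f ` S)"
    and "uniformly_continuous_map (submetric (metric (X, d)) S) euclidean_metric f"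
  shows "\<exists>g :: 'a \<Rightarrow> real.
    (\<forall>x\<in>S. g x = f x) \<and>
    increasing_on R X g \<and>
    uniformly_continuous_map (metric (X, d)) euclidean_metric g"
proof -
  interpret radial_metric_poset X d R
    by fact
  have "\<exists>\<delta>>0. \<forall>x\<in>S. \<forall>y\<in>S. d x y < \<delta> \<longrightarrow> \<bar>f x - f y\<bar> < e" if "e > 0" for e
    using assms(5) that assms(2) commute
    by (auto simp: uniformly_continuous_map_def dist_real_def Int_absorb2 abs_minus_commute)
  then obtain w where w: "mono_on {0..} w" "w 0 = 0"
      and subadd: "\<And>s t. s \<ge> 0 \<Longrightarrow> t \<ge> 0 \<Longrightarrow> w (s + t) \<le> w s + w t"
      and modulus: "\<And>x y. x \<in> S \<Longrightarrow> y \<in> S \<Longrightarrow> \<bar>f x - f y\<bar> \<le> w (d x y)"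
      and small: "\<And>e. e > 0 \<Longrightarrow> \<exists>\<delta>>0. \<forall>t. 0 \<le> t \<and> t < \<delta> \<longrightarrow> w t < e"
    using subadditive_modulus_exists[of d f S] assms(4) by (metis nonneg)
  obtain g where g: "\<And>x. x \<in> S \<Longrightarrow> g x = f x" "increasing_on R X g"
      "\<And>x y. x \<in> X \<Longrightarrow> y \<in> X \<Longrightarrow> \<bar>g x - g y\<bar> \<le> w (d x y)"
    using increasing_extension_with_modulus[OF w subadd assms(2,3)
        bounded_imp_bdd_below[OF assms(4)] modulus]
    by metis
  have "uniformly_continuous_map (metric (X, d)) euclidean_metric g"
    unfolding uniformly_continuous_map_def
  proof (intro conjI allI impI)
    fix e :: real assume "e > 0"
    then obtain \<delta> where \<delta>: "\<delta> > 0" "\<And>t. 0 \<le> t \<Longrightarrow> t < \<delta> \<Longrightarrow> w t < e"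
      using small by blast
    have "dist (g y) (g x) < e" if "x \<in> X" "y \<in> X" "d y x < \<delta>" for x y
      using g(3)[OF that(2,1)] \<delta>(2)[of "d y x"] that(3) by (simp add: dist_real_def)
    then show "\<exists>\<delta>>0. \<forall>x\<in>mspace (metric (X, d)). \<forall>y\<in>mspace (metric (X, d)).
        mdist (metric (X, d)) y x < \<delta> \<longrightarrow> mdist euclidean_metric (g y) (g x) < e"
      using \<delta>(1) by auto
  qed simp
  with g(1,2) show ?thesis
    by blast
qed

end
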